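(* Let $\mathcal{B}$ be the Lie conformal algebra of Block type, i.e. the free $\mathbb{C}[\partial]$-module with basis $\{J_i \mid i\in\mathbb{Z}^+\}$ and $\lambda$-bracket determined by $[J_{i\,\lambda}J_j]=((i+1)\partial+(i+j+2)\lambda)J_{i+j}$ for $i,j\in\mathbb{Z}^+$. Then every conformal derivation of $\mathcal{B}$ is inner; that is, for every conformal derivation $d$ of $\mathcal{B}$ there exists $a\in\mathcal{B}$ such that $d_\lambda b=[a_\lambda b]$ for all $b\in\mathcal{B}$.
   Context: $\mathbb{Z}^+$ denotes the set of nonnegative integers; all vector spaces are over $\mathbb{C}$. A Lie conformal algebra $\mathcal{R}$ is a $\mathbb{C}[\partial]$-module with a $\mathbb{C}$-bilinear map $\mathcal{R}\otimes\mathcal{R}\to\mathbb{C}[\lambda]\otimes\mathcal{R}$, $a\otimes b\mapsto[a_\lambda b]$, such that for $a,b,c\in\mathcal{R}$: $[\partial a_\lambda b]=-\lambda[a_\lambda b]$, $[a_\lambda\partial b]=(\partial+\lambda)[a_\lambda b]$; $[a_\lambda b]=-[b_{-\lambda-\partial}a]$; $[a_\lambda[b_\mu c]]=[[a_\lambda b]_{\lambda+\mu}c]+[b_\mu[a_\lambda c]]$. The bracket of $\mathcal{B}$ is extended from the basis elements $J_i$ to all of $\mathcal{B}$ by the first pair of identities. A conformal linear map between $\mathbb{C}[\partial]$-modules $V$ and $W$ is a $\mathbb{C}$-linear map $\phi_\lambda:V\to W[\lambda]$ such that $\phi_\lambda(\partial v)=(\partial+\lambda)\phi_\lambda(v)$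 for all $v\in V$. A conformal derivation of a Lie conformal algebra $\mathcal{R}$ is a conformal linear map $d_\lambda:\mathcal{R}\to\mathcal{R}[\lambda]$ such that $d_\lambda[a_\mu b]=[(d_\lambda a)_{\lambda+\mu}b]+[a_\mu(d_\lambda b)]$ for all $a,b\in\mathcal{R}$. For $a\in\mathcal{R}$, the map $(\mathrm{ad}\,a)_\lambda b=[a_\lambda b]$ is a conformal derivation; conformal derivations of this form are called inner. *)

theory Defs
  imports Complex_Main
    "HOL-Computational_Algebra.Polynomial"
    "HOL-Library.Poly_Mapping"
begin

text \<open>
  A \<open>\<complex>[\<partial>]\<close>-module is a \<^locale>\<open>module\<close> over \<^typ>\<open>complex poly\<close>; \<open>\<partial>\<close> is the action of \<^term>\<open>[:0, 1:]\<close> and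
  \<open>c \<in> \<complex>\<close> acts as \<^term>\<open>[:c:]\<close>. For a module on the type \<open>'v\<close>, \<open>V[\<lambda>]\<close> is \<open>'v poly\<close>, and
  \<open>V[\<lambda>,\<mu>]\<close> is \<open>'v poly poly\<close> with inner variable \<open>\<lambda>\<close> and outer variable \<open>\<mu>\<close>.
\<close>

definition cscale :: "(complex poly \<Rightarrow> 'v \<Rightarrow> 'v) \<Rightarrow> complex \<Rightarrow> 'v \<Rightarrow> 'v" where
  "cscale scale c v = scale [:c:] v"

definition partial_op :: "(complex poly \<Rightarrow> 'v \<Rightarrow> 'v) \<Rightarrow> 'v \<Rightarrow> 'v" where
  "partial_op scale v = scale [:0, 1:] v"

text \<open>
  For \<open>p = \<Sum>\<^sub>n \<lambda>\<^sup>n v\<^sub>n\<close>, the value \<open>\<Sum>\<^sub>n T\<^sup>n (e v\<^sub>n)\<close>: the operator \<open>T\<close> is substituted for the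
  variable, and \<open>e\<close> is applied to the coefficients.
\<close>

definition lsubst :: "('w::comm_monoid_add \<Rightarrow> 'w) \<Rightarrow> ('v::zero \<Rightarrow> 'w) \<Rightarrow> 'v poly \<Rightarrow> 'w" where
  "lsubst T e p = (\<Sum>n\<le>degree p. (T ^^ n) (e (coeff p n)))"

text \<open>Multiplication by \<open>\<lambda>\<close> and by \<open>\<partial> + \<lambda>\<close> on \<open>V[\<lambda>]\<close>.\<close>

definition lam_op :: "'v::zero poly \<Rightarrow> 'v poly" where
  "lam_op p = pCons 0 p"

definition partial_lam :: "(complex poly \<Rightarrow> 'v \<Rightarrow> 'v) \<Rightarrow> 'v::comm_monoid_add poly \<Rightarrow> 'v poly" where
  "partial_lam scale p = map_poly (partial_op scale) p + lam_op p"

text \<open>Multiplication by \<open>\<lambda>\<close> and by \<open>\<lambda> + \<mu>\<close> on \<open>V[\<lambda>,\<mu>]\<close>.\<close>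

definition lam2 :: "'v::zero poly poly \<Rightarrow> 'v poly poly" where
  "lam2 q = map_poly lam_op q"

definition lam_mu :: "'v::comm_monoid_add poly poly \<Rightarrow> 'v poly poly" where
  "lam_mu q = lam2 q + pCons 0 q"

text \<open>
  The elements \<open>[p\<^bsub>\<lambda>+\<mu>\<^esub> b]\<close> and \<open>[a\<^bsub>\<mu>\<^esub> p]\<close> of \<open>V[\<lambda>,\<mu>]\<close>, for \<open>p \<in> V[\<lambda>]\<close>. For \<open>q \<in> V[\<mu>]\<close>, the
  element \<open>[a\<^bsub>\<lambda>\<^esub> q]\<close> is \<^term>\<open>map_poly (br a) q\<close>.
\<close>

definition br_lam_mu ::
  "('v \<Rightarrow> 'v \<Rightarrow> 'v poly) \<Rightarrow> 'v poly \<Rightarrow> 'v \<Rightarrow> 'v::comm_monoid_add poly poly" where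
  "br_lam_mu br p b = lsubst lam2 (\<lambda>a. lsubst lam_mu (\<lambda>v. [:[:v:]:]) (br a b)) p"

definition br_mu ::
  "('v \<Rightarrow> 'v \<Rightarrow> 'v poly) \<Rightarrow> 'v \<Rightarrow> 'v poly \<Rightarrow> 'v::comm_monoid_add poly poly" where
  "br_mu br a p = lsubst lam2 (\<lambda>b. map_poly (\<lambda>v. [:v:]) (br a b)) p"

locale lie_conformal_algebra = module scale
  for scale :: "complex poly \<Rightarrow> 'v::ab_group_add \<Rightarrow> 'v" +
  fixes br :: "'v \<Rightarrow> 'v \<Rightarrow> 'v poly"
  assumes br_add_left: "br (a + a') b = br a b + br a' b"
    and br_add_right: "br a (b + b') = br a b + br a b'"
    and br_cscale_left: "br (cscale scale r a) b = map_poly (cscale scale r) (br a b)"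
    and br_cscale_right: "br a (cscale scale r b) = map_poly (cscale scale r) (br a b)"
    and br_partial_left: "br (partial_op scale a) b = - lam_op (br a b)"
    and br_partial_right: "br a (partial_op scale b) = partial_lam scale (br a b)"
    and br_skew: "br a b = - lsubst (\<lambda>p. - partial_lam scale p) (\<lambda>v. [:v:]) (br b a)"
    and br_jacobi: "map_poly (br a) (br b c) = br_lam_mu br (br a b) c + br_mu br b (br a c)"

definition conformal_linear ::
  "(complex poly \<Rightarrow> 'v \<Rightarrow> 'v) \<Rightarrow> (complex poly \<Rightarrow> 'w \<Rightarrow> 'w) \<Rightarrow>
    ('v::ab_group_add \<Rightarrow> 'w::ab_group_add poly) \<Rightarrow> bool" where
  "conformal_linear scaleV scaleW \<phi> \<longleftrightarrow>
     (\<forall>u v. \<phi> (u + v) = \<phi> u + \<phi> v) \<and>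
     (\<forall>c v. \<phi> (cscale scaleV c v) = map_poly (cscale scaleW c) (\<phi> v)) \<and>
     (\<forall>v. \<phi> (partial_op scaleV v) = partial_lam scaleW (\<phi> v))"

definition (in lie_conformal_algebra) conformal_derivation :: "('v \<Rightarrow> 'v poly) \<Rightarrow> bool" where
  "conformal_derivation d \<longleftrightarrow>
     conformal_linear scale scale d \<and>
     (\<forall>a b. map_poly d (br a b) = br_lam_mu br (d a) b + br_mu br a (d b))"


type_synonym block = "nat \<Rightarrow>\<^sub>0 complex poly"

definition block_J :: "nat \<Rightarrow> block" where
  "block_J i = Poly_Mapping.single i 1"

definition block_scale :: "complex poly \<Rightarrow> block \<Rightarrow> block" where
  "block_scale f v = Poly_Mapping.map (\<lambda>g. f * g) v"

definition J_bracket :: "nat \<Rightarrow> nat \<Rightarrow> block poly" where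
  "J_bracket i j =
     [:block_scale [:0, of_nat (i + 1):] (block_J (i + j)), block_scale [:of_nat (i + j + 2):] (block_J (i + j)):]"

text \<open>
  \<open>f(-\<lambda>) g(\<partial> + \<lambda>) p\<close> for \<open>p \<in> \<B>[\<lambda>]\<close>; by sesquilinearity
  \<open>[f(\<partial>)J\<^sub>i \<^bsub>\<lambda>\<^esub> g(\<partial>)J\<^sub>j] = f(-\<lambda>) g(\<partial> + \<lambda>) [J\<^sub>i \<^bsub>\<lambda>\<^esub> J\<^sub>j]\<close>.
\<close>

definition sesqui :: "complex poly \<Rightarrow> complex poly \<Rightarrow> block poly \<Rightarrow> block poly" where
  "sesqui f g p =
     lsubst (\<lambda>q. - lam_op q) (\<lambda>c. map_poly (cscale block_scale c)
       (lsubst (partial_lam block_scale) (\<lambda>c'. map_poly (cscale block_scale c') p) g)) f"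

definition block_bracket :: "block \<Rightarrow> block \<Rightarrow> block poly" where
  "block_bracket a b = (\<Sum>i\<in>Poly_Mapping.keys a. \<Sum>j\<in>Poly_Mapping.keys b.
     sesqui (Poly_Mapping.lookup a i) (Poly_Mapping.lookup b j) (J_bracket i j))"


text \<open>
  To compare elements of \<open>\<B>\<close>, \<open>\<B>[\<lambda>]\<close>, \<open>\<B>[\<lambda>,\<mu>]\<close>, take the coefficient of \<open>J\<^sub>i\<close> and evaluate at
  \<open>\<partial> = x\<close>, \<open>\<lambda> = y\<close>, \<open>\<mu> = z\<close>.
\<close>

definition evb :: "nat \<Rightarrow> complex \<Rightarrow> block \<Rightarrow> complex" where
  "evb i x v = poly (Poly_Mapping.lookup v i) x"

definition evp :: "nat \<Rightarrow> complex \<Rightarrow> complex \<Rightarrow> block poly \<Rightarrow> complex" where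
  "evp i x y p = poly (map_poly (evb i x) p) y"

definition evpp :: "nat \<Rightarrow> complex \<Rightarrow> complex \<Rightarrow> complex \<Rightarrow> block poly poly \<Rightarrow> complex" where
  "evpp i x y z q = poly (map_poly (evp i x y) q) z"

lemma evb_0 [simp]: "evb i x 0 = 0"
  by (simp add: evb_def)

lemma evp_0 [simp]: "evp i x y 0 = 0"
  by (simp add: evp_def)

lemma evpp_0 [simp]: "evpp i x y z 0 = 0"
  by (simp add: evpp_def)

lemma map_poly_additive:
  assumes "\<And>u v. f (u + v) = f u + (f v :: 'b::comm_monoid_add)" "f 0 = 0"
  shows "map_poly f (p + q) = map_poly f p + map_poly f q"
  by (rule poly_eqI) (simp add: coeff_map_poly assms)

lemma evb_add [simp]: "evb i x (u + v) = evb i x u + evb i x v"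
  by (simp add: evb_def lookup_add)

lemma evp_add [simp]: "evp i x y (p + q) = evp i x y p + evp i x y q"
  by (simp add: evp_def map_poly_additive)

lemma evpp_add [simp]: "evpp i x y z (p + q) = evpp i x y z p + evpp i x y z q"
  by (simp add: evpp_def map_poly_additive)

lemma evp_minus [simp]: "evp i x y (- p) = - evp i x y p"
  using evp_add[of i x y p "- p"] by (simp add: add_eq_0_iff)

lemma evb_eqI: "(\<And>i x. evb i x u = evb i x v) \<Longrightarrow> u = v"
  by (rule poly_mapping_eqI) (auto simp: evb_def poly_eq_poly_eq_iff[symmetric])

lemma evp_eqI:
  assumes "\<And>i x y. evp i x y p = evp i x y q"
  shows "p = q"
proof (rule poly_eqI, rule evb_eqI)
  fix n i x
  have "map_poly (evb i x) p = map_poly (evb i x) q"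
    using assms by (auto simp: evp_def poly_eq_poly_eq_iff[symmetric])
  from arg_cong[OF this, of "\<lambda>p. coeff p n"]
  show "evb i x (coeff p n) = evb i x (coeff q n)" by (simp add: coeff_map_poly)
qed

lemma evpp_eqI:
  assumes "\<And>i x y z. evpp i x y z p = evpp i x y z q"
  shows "p = q"
proof (rule poly_eqI, rule evp_eqI)
  fix n i x y
  have "map_poly (evp i x y) p = map_poly (evp i x y) q"
    using assms by (auto simp: evpp_def poly_eq_poly_eq_iff[symmetric])
  from arg_cong[OF this, of "\<lambda>p. coeff p n"]
  show "evp i x y (coeff p n) = evp i x y (coeff q n)" by (simp add: coeff_map_poly)
qed

lemma poly_map_poly_lincomb:
  fixes g :: "'i \<Rightarrow> 'v::zero \<Rightarrow> complex"
  assumes "finite I" "\<And>i. g i 0 = 0" 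
  shows "poly (map_poly (\<lambda>v. \<Sum>i\<in>I. c i * g i v) p) z = (\<Sum>i\<in>I. c i * poly (map_poly (g i) p) z)"
proof -
  have "map_poly (\<lambda>v. \<Sum>i\<in>I. c i * g i v) p = (\<Sum>i\<in>I. smult (c i) (map_poly (g i) p))"
    by (rule poly_eqI) (simp add: coeff_map_poly assms coeff_sum)
  then show ?thesis by (simp add: poly_sum)
qed

lemma poly_map_poly_scaled:
  fixes g :: "'v::zero \<Rightarrow> complex"
  assumes "g 0 = 0"
  shows "poly (map_poly (\<lambda>v. c * g v) p) z = c * poly (map_poly g p) z"
  using poly_map_poly_lincomb[of "{()}" "\<lambda>_. g" "\<lambda>_. c" p z] assms by simp

lemma lsubst_eval:
  fixes \<psi> :: "'w::comm_monoid_add \<Rightarrow> complex"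
  assumes add: "\<And>u v. \<psi> (u + v) = \<psi> u + \<psi> v" and z: "\<psi> 0 = 0"
    and T: "\<And>w. \<psi> (T w) = t * \<psi> w" and e: "e 0 = 0"
  shows "\<psi> (lsubst T e p) = poly (map_poly (\<lambda>v. \<psi> (e v)) p) t"
proof -
  have pw: "\<psi> ((T ^^ n) w) = t ^ n * \<psi> w" for n w
    by (induction n) (auto simp: T)
  have sm: "\<psi> (sum h A) = (\<Sum>a\<in>A. \<psi> (h a))" for h and A :: "nat set"
    by (induction A rule: infinite_finite_induct) (auto simp: add z)
  have "degree (map_poly (\<lambda>v. \<psi> (e v)) p) \<le> degree p"
    by (rule degree_le) (auto simp: coeff_map_poly z e coeff_eq_0)
  then have "poly (map_poly (\<lambda>v. \<psi> (e v)) p) t = (\<Sum>n\<le>degree p. \<psi> (e (coeff p n)) * t ^ n)"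
  proof -
    let ?q = "map_poly (\<lambda>v. \<psi> (e v)) p"
    assume le: "degree ?q \<le> degree p"
    have "poly ?q t = (\<Sum>n\<le>degree ?q. coeff ?q n * t ^ n)" by (rule poly_altdef)
    also have "\<dots> = (\<Sum>n\<le>degree p. coeff ?q n * t ^ n)"
      using le by (intro sum.mono_neutral_left) (auto simp: coeff_eq_0)
    finally show ?thesis by (simp add: coeff_map_poly z e)
  qed
  then show ?thesis by (simp add: lsubst_def sm pw mult.commute)
qed


lemma evb_block_scale [simp]: "evb i x (block_scale f v) = poly f x * evb i x v"
  by (simp add: evb_def block_scale_def Poly_Mapping.map.rep_eq when_def)

lemma block_module: "module block_scale"
  by standard (auto intro!: evb_eqI simp: algebra_simps)

lemma block_scale_0 [simp]: "block_scale f 0 = 0"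
  by (rule evb_eqI) simp

lemma evb_cscale [simp]: "evb i x (cscale block_scale c v) = c * evb i x v"
  by (simp add: cscale_def)

lemma evb_partial [simp]: "evb i x (partial_op block_scale v) = x * evb i x v"
  by (simp add: partial_op_def)

lemma evp_map_poly:
  assumes "F 0 = 0"
  shows "evp i x y (map_poly F p) = poly (map_poly (\<lambda>v. evb i x (F v)) p) y"
  by (simp add: evp_def map_poly_map_poly assms o_def)

lemma evpp_map_poly:
  assumes "F 0 = 0"
  shows "evpp i x y z (map_poly F p) = poly (map_poly (\<lambda>v. evp i x y (F v)) p) z"
  by (simp add: evpp_def map_poly_map_poly assms o_def)

lemma evp_cscale [simp]: "evp i x y (map_poly (cscale block_scale c) p) = c * evp i x y p"
  by (subst evp_map_poly) (simp_all add: cscale_def poly_map_poly_scaled evp_def)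

lemma evp_lam [simp]: "evp i x y (lam_op p) = y * evp i x y p"
  by (simp add: evp_def lam_op_def map_poly_pCons)

lemma evp_partial_lam [simp]: "evp i x y (partial_lam block_scale p) = (x + y) * evp i x y p"
proof -
  have "evp i x y (map_poly (partial_op block_scale) p) = x * evp i x y p"
    by (subst evp_map_poly) (simp_all add: partial_op_def poly_map_poly_scaled evp_def)
  then show ?thesis by (simp add: partial_lam_def algebra_simps)
qed

lemma evp_const [simp]: "evp i x y [:v:] = evb i x v"
  by (simp add: evp_def map_poly_pCons)

lemma evpp_lam2 [simp]: "evpp i x y z (lam2 q) = y * evpp i x y z q"
  unfolding lam2_def by (subst evpp_map_poly) (simp_all add: poly_map_poly_scaled evpp_def, simp add: lam_op_def)

lemma evpp_lam_mu [simp]: "evpp i x y z (lam_mu q) = (y + z) * evpp i x y z q"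
proof -
  have "evpp i x y z (pCons 0 q) = z * evpp i x y z q"
    by (simp add: evpp_def map_poly_pCons)
  then show ?thesis by (simp add: lam_mu_def algebra_simps)
qed

lemma evpp_const [simp]: "evpp i x y z [:p:] = evp i x y p"
  by (simp add: evpp_def map_poly_pCons)

lemma evp_sesqui: "evp k x y (sesqui f g p) = poly f (- y) * poly g (x + y) * evp k x y p"
proof -
  have mp: "map_poly (\<lambda>c. c * (r::complex)) h = smult r h" for r h
    by (rule poly_eqI) (simp add: coeff_map_poly)
  have z: "map_poly (cscale block_scale 0) q = 0" for q
    by (rule evp_eqI) simp
  have "evp k x y (lsubst (partial_lam block_scale) (\<lambda>c'. map_poly (cscale block_scale c') p) g)
      = poly g (x + y) * evp k x y p"
    by (subst lsubst_eval[where \<psi> = "evp k x y" and t = "x + y"]) (simp_all add: z mp)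
  then show ?thesis unfolding sesqui_def
    by (subst lsubst_eval[where \<psi> = "evp k x y" and t = "- y"]) (simp_all add: z mp)
qed

lemma evp_J_bracket:
  "evp k x y (J_bracket i j) = (if k = i + j then of_nat (i + 1) * x + of_nat (k + 2) * y else 0)"
  by (simp add: evp_def J_bracket_def map_poly_pCons) 
    (simp add: evb_def block_J_def lookup_single when_def algebra_simps)

lemma evp_sum: "evp k x y (sum h A) = (\<Sum>a\<in>A. evp k x y (h a))"
  by (induction A rule: infinite_finite_induct) auto

lemma evp_block_bracket:
  "evp k x y (block_bracket a b) =
     (\<Sum>i\<le>k. evb i (- y) a * evb (k - i) (x + y) b * (of_nat (i + 1) * x + of_nat (k + 2) * y))"
proof -
  define K where "K = Poly_Mapping.keys a \<union> {..k}"
  define L where "L = Poly_Mapping.keys b \<union> {..k}"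
  define w where "w i = of_nat (i + 1) * x + of_nat (k + 2) * y" for i :: nat
  have fin: "finite K" "finite L" by (auto simp: K_def L_def)
  have nz: "evb i t v = 0" if "i \<notin> Poly_Mapping.keys v" for i t v
    using that by (simp add: evb_def in_keys_iff)
  have "evp k x y (block_bracket a b) = (\<Sum>i\<in>Poly_Mapping.keys a. \<Sum>j\<in>Poly_Mapping.keys b.
      evb i (- y) a * evb j (x + y) b * (if k = i + j then w i else 0))"
    by (simp only: block_bracket_def evp_sum evp_sesqui evp_J_bracket evb_def w_def)
  also have "\<dots> = (\<Sum>i\<in>Poly_Mapping.keys a. \<Sum>j\<in>L.
      evb i (- y) a * evb j (x + y) b * (if k = i + j then w i else 0))"
    by (intro sum.cong refl sum.mono_neutral_left fin) (auto simp: L_def nz)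
  also have "\<dots> = (\<Sum>i\<in>K. \<Sum>j\<in>L.
      evb i (- y) a * evb j (x + y) b * (if k = i + j then w i else 0))"
    by (intro sum.mono_neutral_left fin) (auto simp: K_def nz)
  also have "\<dots> = (\<Sum>i\<in>K. if i \<le> k then evb i (- y) a * evb (k - i) (x + y) b * w i else 0)"
  proof (rule sum.cong[OF refl])
    fix i assume "i \<in> K"
    have "(\<Sum>j\<in>L. evb i (- y) a * evb j (x + y) b * (if k = i + j then w i else 0)) =
      (\<Sum>j\<in>L. if j = k - i then (if i \<le> k then evb i (- y) a * evb (k - i) (x + y) b * w i else 0) else 0)"
      by (rule sum.cong) auto
    also have "\<dots> = (if i \<le> k then evb i (- y) a * evb (k - i) (x + y) b * w i else 0)"
      by (simp add: fin) (auto simp: L_def)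
    finally show "(\<Sum>j\<in>L. evb i (- y) a * evb j (x + y) b * (if k = i + j then w i else 0)) = \<dots>" .
  qed
  also have "\<dots> = (\<Sum>i\<le>k. evb i (- y) a * evb (k - i) (x + y) b * w i)"
    by (rule sum.mono_neutral_cong_right) (auto simp: fin K_def)
  finally show ?thesis by (simp only: w_def)
qed

lemma block_bracket_J: "block_bracket (block_J i) (block_J j) = J_bracket i j"
proof (rule evp_eqI)
  have l: "Poly_Mapping.lookup (block_J i) n = (if n = i then 1 else 0)" for i n
    by (simp add: block_J_def lookup_single when_def)
  have "Poly_Mapping.keys (block_J i) = {i}" for i
    by (simp add: block_J_def)
  then show "evp k x y (block_bracket (block_J i) (block_J j)) = evp k x y (J_bracket i j)" for k x y
    by (simp add: block_bracket_def evp_sesqui l)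
qed

lemma block_bracket_0 [simp]: "block_bracket 0 b = 0" "block_bracket a 0 = 0"
  by (simp_all add: block_bracket_def)

lemma lsubst_0 [simp]: "e 0 = 0 \<Longrightarrow> lsubst T e 0 = 0"
  by (simp add: lsubst_def)

lemma evpp_br_lam_mu:
  "evpp k x y z (br_lam_mu block_bracket p b) =
     (\<Sum>i\<le>k. evp i (- y - z) y p * evb (k - i) (x + y + z) b *
        (of_nat (i + 1) * x + of_nat (k + 2) * (y + z)))"
proof -
  have inner: "evpp k x y z (lsubst lam_mu (\<lambda>v. [:[:v:]:]) q) = evp k x (y + z) q" for q
    by (subst lsubst_eval[where \<psi> = "evpp k x y z" and t = "y + z"]) (simp_all add: evp_def[symmetric])
  have "evpp k x y z (br_lam_mu block_bracket p b) =
      poly (map_poly (\<lambda>a. evp k x (y + z) (block_bracket a b)) p) y"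
    unfolding br_lam_mu_def
    by (subst lsubst_eval[where \<psi> = "evpp k x y z" and t = y]) (simp_all add: inner)
  also have "\<dots> = poly (map_poly (\<lambda>a. \<Sum>i\<le>k. (evb (k - i) (x + (y + z)) b *
      (of_nat (i + 1) * x + of_nat (k + 2) * (y + z))) * evb i (- (y + z)) a) p) y"
    by (simp only: evp_block_bracket mult_ac)
  also have "\<dots> = (\<Sum>i\<le>k. (evb (k - i) (x + (y + z)) b *
      (of_nat (i + 1) * x + of_nat (k + 2) * (y + z))) * evp i (- (y + z)) y p)"
    by (subst poly_map_poly_lincomb) (simp_all add: evp_def)
  finally show ?thesis by (simp add: mult_ac add.assoc)
qed

lemma evpp_br_mu:
  "evpp k x y z (br_mu block_bracket a p) =
     (\<Sum>i\<le>k. evb i (- z) a * evp (k - i) (x + z) y p *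
        (of_nat (i + 1) * x + of_nat (k + 2) * z))"
proof -
  have inner: "evpp k x y z (map_poly (\<lambda>v. [:v:]) q) = evp k x z q" for q
    by (subst evpp_map_poly) (simp_all, simp add: evp_def)
  have "evpp k x y z (br_mu block_bracket a p) =
      poly (map_poly (\<lambda>b. evp k x z (block_bracket a b)) p) y"
    unfolding br_mu_def
    by (subst lsubst_eval[where \<psi> = "evpp k x y z" and t = y]) (simp_all add: inner)
  also have "\<dots> = poly (map_poly (\<lambda>b. \<Sum>i\<le>k. (evb i (- z) a *
      (of_nat (i + 1) * x + of_nat (k + 2) * z)) * evb (k - i) (x + z) b) p) y"
    by (simp only: evp_block_bracket mult_ac)
  also have "\<dots> = (\<Sum>i\<le>k. (evb i (- z) a *
      (of_nat (i + 1) * x + of_nat (k + 2) * z)) * evp (k - i) (x + z) y p)"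
    by (subst poly_map_poly_lincomb) (simp_all add: evp_def)
  finally show ?thesis by (simp add: mult_ac)
qed

lemma evpp_ad_br:
  "evpp k x y z (map_poly (block_bracket a) p) =
     (\<Sum>i\<le>k. evb i (- y) a * evp (k - i) (x + y) z p *
        (of_nat (i + 1) * x + of_nat (k + 2) * y))"
proof -
  have "evpp k x y z (map_poly (block_bracket a) p) =
      poly (map_poly (\<lambda>b. \<Sum>i\<le>k. (evb i (- y) a *
      (of_nat (i + 1) * x + of_nat (k + 2) * y)) * evb (k - i) (x + y) b) p) z"
    by (subst evpp_map_poly) (simp, simp only: evp_block_bracket mult_ac)
  also have "\<dots> = (\<Sum>i\<le>k. (evb i (- y) a *
      (of_nat (i + 1) * x + of_nat (k + 2) * y)) * evp (k - i) (x + y) z p)"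
    by (subst poly_map_poly_lincomb) (simp_all add: evp_def)
  finally show ?thesis by (simp add: mult_ac)
qed

lemma sum_triangle:
  fixes g :: "nat \<Rightarrow> nat \<Rightarrow> complex"
  shows "(\<Sum>i\<le>k. \<Sum>j\<le>k - i. g i j) = (\<Sum>(i, j)\<in>{(i, j). i + j \<le> k}. g i j)"
proof -
  have "(\<Sum>i\<le>k. \<Sum>j\<le>k - i. g i j) = (\<Sum>(i, j)\<in>(SIGMA i:{..k}. {..k - i}). g i j)"
    by (rule sum.Sigma) auto
  also have "(SIGMA i:{..k}. {..k - i}) = {(i, j). i + j \<le> k}" by auto
  finally show ?thesis .
qed

lemma jacobi_identity:
  fixes I J N m x y z :: complex
  shows "m * ((J + 1) * (x + y) + (J + N + 2) * z) * ((I + 1) * x + (I + J + N + 2) * y) =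
    m * ((I + 1) * (- y - z) + (I + J + 2) * y) * ((I + J + 1) * x + (I + J + N + 2) * (y + z)) +
    m * ((I + 1) * (x + z) + (I + N + 2) * y) * ((J + 1) * x + (I + J + N + 2) * z)"
  by (simp add: algebra_simps)

lemma block_jacobi:
  "map_poly (block_bracket a) (block_bracket b c) =
     br_lam_mu block_bracket (block_bracket a b) c + br_mu block_bracket b (block_bracket a c)"
proof (rule evpp_eqI)
  fix k x y z
  define T where "T = {(i, j). i + j \<le> (k::nat)}"
  define m where "m i j = evb i (- y) a * evb j (- z) b * evb (k - i - j) (x + y + z) c" for i j
  define f1 where "f1 i j = m i j * (of_nat (j + 1) * (x + y) + of_nat (k - i + 2) * z) *
      (of_nat (i + 1) * x + of_nat (k + 2) * y)" for i j :: nat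
  define f2 where "f2 i j = m i j * (of_nat (i + 1) * (- y - z) + of_nat (i + j + 2) * y) *
      (of_nat (i + j + 1) * x + of_nat (k + 2) * (y + z))" for i j :: nat
  define f3 where "f3 i j = m i j * (of_nat (i + 1) * (x + z) + of_nat (k - j + 2) * y) *
      (of_nat (j + 1) * x + of_nat (k + 2) * z)" for i j :: nat
  have 1: "evpp k x y z (map_poly (block_bracket a) (block_bracket b c)) = (\<Sum>(i, j)\<in>T. f1 i j)"
    unfolding evpp_ad_br evp_block_bracket T_def sum_triangle[symmetric]
      sum_distrib_left sum_distrib_right f1_def m_def
    by (intro sum.cong refl) (simp only: mult_ac)
  have "evpp k x y z (br_lam_mu block_bracket (block_bracket a b) c) =
      (\<Sum>n\<le>k. \<Sum>i\<le>n. f2 i (n - i))"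
    unfolding evpp_br_lam_mu evp_block_bracket sum_distrib_left sum_distrib_right f2_def m_def
  proof (intro sum.cong refl)
    fix n i assume "n \<in> {..k}" "i \<in> {..n}"
    then have "- y - z + y = - z" "k - i - (n - i) = k - n" "i + (n - i) = n" by auto
    then show "evb i (- y) a * evb (n - i) (- y - z + y) b *
        (of_nat (i + 1) * (- y - z) + of_nat (n + 2) * y) * evb (k - n) (x + y + z) c *
        (of_nat (n + 1) * x + of_nat (k + 2) * (y + z)) =
      evb i (- y) a * evb (n - i) (- z) b * evb (k - i - (n - i)) (x + y + z) c *
        (of_nat (i + 1) * (- y - z) + of_nat (i + (n - i) + 2) * y) *
        (of_nat (i + (n - i) + 1) * x + of_nat (k + 2) * (y + z))"
      by (simp only: mult_ac)
  qed
  also have "\<dots> = (\<Sum>(i, j)\<in>T. f2 i j)"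
    unfolding T_def by (rule sum.triangle_reindex_eq[symmetric])
  finally have 2: "evpp k x y z (br_lam_mu block_bracket (block_bracket a b) c) = \<dots>" .
  have "evpp k x y z (br_mu block_bracket b (block_bracket a c)) = (\<Sum>j\<le>k. \<Sum>i\<le>k - j. f3 i j)"
    unfolding evpp_br_mu evp_block_bracket sum_distrib_left sum_distrib_right f3_def m_def
  proof (intro sum.cong refl)
    fix j i
    have "k - j - i = k - i - j" "x + z + y = x + y + z" by auto
    then show "evb j (- z) b * (evb i (- y) a * evb (k - j - i) (x + z + y) c *
        (of_nat (i + 1) * (x + z) + of_nat (k - j + 2) * y)) *
        (of_nat (j + 1) * x + of_nat (k + 2) * z) =
      evb i (- y) a * evb j (- z) b * evb (k - i - j) (x + y + z) c *
        (of_nat (i + 1) * (x + z) + of_nat (k - j + 2) * y) *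
        (of_nat (j + 1) * x + of_nat (k + 2) * z)"
      by (simp only: mult_ac)
  qed
  also have "\<dots> = (\<Sum>(j, i)\<in>T. f3 i j)"
    unfolding T_def by (rule sum_triangle)
  also have "\<dots> = (\<Sum>(i, j)\<in>T. f3 i j)"
    by (rule sum.reindex_bij_witness[of _ "\<lambda>(i, j). (j, i)" "\<lambda>(i, j). (j, i)"]) (auto simp: T_def)
  finally have 3: "evpp k x y z (br_mu block_bracket b (block_bracket a c)) = \<dots>" .
  have "f1 i j = f2 i j + f3 i j" if ij: "i + j \<le> k" for i j
  proof -
    obtain n where k: "k = i + j + n" using le_Suc_ex[OF ij] by blast
    have e: "k - i + 2 = j + n + 2" "k - j + 2 = i + n + 2" "k + 2 = i + j + n + 2"
      using k by auto
    show ?thesis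
      unfolding f1_def f2_def f3_def e of_nat_add of_nat_1 of_nat_numeral
      by (rule jacobi_identity)
  qed
  then have "(\<Sum>(i, j)\<in>T. f1 i j) = (\<Sum>(i, j)\<in>T. f2 i j + f3 i j)"
    by (intro sum.cong) (auto simp: T_def)
  also have "\<dots> = (\<Sum>(i, j)\<in>T. f2 i j) + (\<Sum>(i, j)\<in>T. f3 i j)"
    by (simp only: case_prod_unfold sum.distrib)
  finally show "evpp k x y z (map_poly (block_bracket a) (block_bracket b c)) =
      evpp k x y z (br_lam_mu block_bracket (block_bracket a b) c +
        br_mu block_bracket b (block_bracket a c))"
    by (simp add: 1 2 3)
qed

lemma block_skew:
  "block_bracket a b =
     - lsubst (\<lambda>p. - partial_lam block_scale p) (\<lambda>v. [:v:]) (block_bracket b a)"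
proof (rule evp_eqI)
  fix k x y
  have "evp k x y (lsubst (\<lambda>p. - partial_lam block_scale p) (\<lambda>v. [:v:]) (block_bracket b a)) =
      evp k x (- (x + y)) (block_bracket b a)"
    by (subst lsubst_eval[where \<psi> = "evp k x y" and t = "- (x + y)"])
      (simp_all add: evp_def[symmetric] algebra_simps)
  also have "\<dots> = (\<Sum>j\<le>k. evb j (x + y) b * evb (k - j) (- y) a *
      (of_nat (j + 1) * x + of_nat (k + 2) * (- (x + y))))"
    by (simp add: evp_block_bracket add.commute)
  also have "\<dots> = (\<Sum>i\<le>k. evb (k - i) (x + y) b * evb (k - (k - i)) (- y) a *
      (of_nat (k - i + 1) * x + of_nat (k + 2) * (- (x + y))))"
    by (rule sum.reindex_bij_witness[of _ "\<lambda>i. k - i" "\<lambda>i. k - i"]) auto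
  also have "\<dots> = - evp k x y (block_bracket a b)"
    unfolding evp_block_bracket sum_negf[symmetric]
    by (rule sum.cong) (auto simp: of_nat_diff algebra_simps)
  finally show "evp k x y (block_bracket a b) =
      evp k x y (- lsubst (\<lambda>p. - partial_lam block_scale p) (\<lambda>v. [:v:]) (block_bracket b a))"
    by simp
qed

interpretation block: lie_conformal_algebra block_scale block_bracket
proof (intro lie_conformal_algebra.intro lie_conformal_algebra_axioms.intro block_module
    block_skew block_jacobi)
  fix a a' b b' :: block and c :: complex
  show "block_bracket (a + a') b = block_bracket a b + block_bracket a' b"
    by (rule evp_eqI) (simp only: evp_block_bracket evp_add evb_add distrib_right sum.distrib)
  show "block_bracket a (b + b') = block_bracket a b + block_bracket a b'"
    by (rule evp_eqI)
      (simp only: evp_block_bracket evp_add evb_add distrib_left distrib_right sum.distrib add_ac)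
  show "block_bracket (cscale block_scale c a) b =
      map_poly (cscale block_scale c) (block_bracket a b)"
    by (rule evp_eqI) (simp only: evp_block_bracket evp_cscale evb_cscale sum_distrib_left mult_ac)
  show "block_bracket a (cscale block_scale c b) =
      map_poly (cscale block_scale c) (block_bracket a b)"
    by (rule evp_eqI) (simp only: evp_block_bracket evp_cscale evb_cscale sum_distrib_left mult_ac)
  show "block_bracket (partial_op block_scale a) b = - lam_op (block_bracket a b)"
    by (rule evp_eqI)
      (simp only: evp_block_bracket evp_minus evp_lam evb_partial sum_distrib_left
        sum_negf[symmetric] mult_minus_left mult.assoc)
  show "block_bracket a (partial_op block_scale b) = partial_lam block_scale (block_bracket a b)"
    by (rule evp_eqI)
      (simp only: evp_block_bracket evp_partial_lam evb_partial sum_distrib_left mult_ac)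
qed

end

theory Submission
  imports Defs
begin

text \<open>
  Since \<open>[J\<^sub>0 \<^bsub>\<mu>\<^esub> b] = \<partial>b\<close> at \<open>\<mu> = 0\<close>, the derivation property for \<open>J\<^sub>0\<close> and \<open>b\<close> at \<open>\<mu> = 0\<close> reads
  \<open>\<lambda> d\<^sub>\<lambda>(b) = [(d\<^sub>\<lambda> J\<^sub>0)\<^bsub>\<lambda>\<^esub> b]\<close>. By sesquilinearity the right-hand side is \<open>[u\<^bsub>\<lambda>\<^esub> b]\<close>, where
  \<open>u \<in> \<B>\<close> is \<open>d\<^sub>\<lambda> J\<^sub>0\<close> with \<open>-\<partial>\<close> substituted for \<open>\<lambda>\<close>. For \<open>b = J\<^sub>0\<close> and \<open>\<lambda> = 0\<close> this forces \<open>u = -\<partial>a\<close>,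
  hence \<open>\<lambda> d\<^sub>\<lambda>(b) = \<lambda> [a\<^bsub>\<lambda>\<^esub> b]\<close>.
\<close>

lemma evb_J: "evb i x (block_J j) = (if i = j then 1 else 0)"
  by (simp add: evb_def block_J_def lookup_single when_def)

lemma evp_at_0: "evp i x 0 p = evb i x (coeff p 0)"
  by (simp add: evp_def poly_0_coeff_0 coeff_map_poly)

lemma evpp_at_0: "evpp i x y 0 q = evp i x y (coeff q 0)"
  by (simp add: evpp_def poly_0_coeff_0 coeff_map_poly)

lemma sum_atMost_delta_left:
  fixes f g :: "nat \<Rightarrow> complex"
  shows "(\<Sum>i\<le>k. (if i = 0 then 1 else 0) * f i * g i) = f 0 * g 0"
  by (simp add: if_distrib[of "\<lambda>t. t * _"] cong: if_cong)

lemma coeff_0_bracket_J0: "coeff (block_bracket (block_J 0) b) 0 = partial_op block_scale b"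
proof (rule evb_eqI)
  show "evb k x (coeff (block_bracket (block_J 0) b) 0) = evb k x (partial_op block_scale b)" for k x
    by (simp only: evp_at_0[symmetric] evp_block_bracket evb_J sum_atMost_delta_left evb_partial) simp
qed

definition subst_neg_partial :: "block poly \<Rightarrow> block" where
  "subst_neg_partial p = lsubst (\<lambda>v. - partial_op block_scale v) (\<lambda>v. v) p"

lemma evb_minus: "evb i x (- v) = - evb i x v"
  by (simp add: evb_def)

lemma evb_subst_neg_partial: "evb i x (subst_neg_partial p) = evp i x (- x) p"
  unfolding subst_neg_partial_def
  by (subst lsubst_eval[where \<psi> = "evb i x" and t = "- x"]) (simp_all add: evb_minus evp_def)

lemma lam_op_derivation:
  assumes "block.conformal_derivation d"
  shows "lam_op (d b) = block_bracket (subst_neg_partial (d (block_J 0))) b"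
proof (rule evp_eqI)
  fix k x y
  have d0: "d 0 = 0" and dp: "d (partial_op block_scale b) = partial_lam block_scale (d b)"
    and der: "map_poly d (block_bracket (block_J 0) b) =
      br_lam_mu block_bracket (d (block_J 0)) b + br_mu block_bracket (block_J 0) (d b)"
    using assms unfolding block.conformal_derivation_def conformal_linear_def
    by (metis add_cancel_right_left add.right_neutral, blast+)
  \<comment> \<open>The factor \<open>x + y\<close> comes from moving \<open>d\<close> past
    \<partial>; its \<open>x\<close> part will cancel against the \<open>br_mu\<close> term, leaving
    \<lambda>.\<close>
  have "(x + y) * evp k x y (d b) = evpp k x y 0 (map_poly d (block_bracket (block_J 0) b))"
    by (simp add: evpp_at_0 coeff_map_poly d0 coeff_0_bracket_J0 dp)
  \<comment> \<open>At \<mu> = 0 both brackets evaluate \<open>d (block_J 0)\<close> at \<partial> =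
    -y, \<lambda> = y.\<close>
  also have "\<dots> = evp k x y (block_bracket (subst_neg_partial (d (block_J 0))) b) +
      evpp k x y 0 (br_mu block_bracket (block_J 0) (d b))"
    by (simp add: der evpp_br_lam_mu evp_block_bracket evb_subst_neg_partial)
  also have "evpp k x y 0 (br_mu block_bracket (block_J 0) (d b)) = x * evp k x y (d b)"
    by (simp only: evpp_br_mu evb_J sum_atMost_delta_left) simp
  finally show "evp k x y (lam_op (d b)) =
      evp k x y (block_bracket (subst_neg_partial (d (block_J 0))) b)"
    by (simp add: algebra_simps)
qed

lemma evb_0_subst_neg_partial:
  assumes "block.conformal_derivation d"
  shows "evb k 0 (subst_neg_partial (d (block_J 0))) = 0"
proof -
  let ?u = "subst_neg_partial (d (block_J 0))"
  \<comment> \<open>\<lambda> = 0 kills the left side; \<partial> = 1 turns the one surviving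
    bracket coefficient into the nonzero \<open>k + 1\<close>.\<close>
  have "0 = evp k 1 0 (lam_op (d (block_J 0)))"
    by simp
  also have "\<dots> = (\<Sum>i\<le>k. if i = k then evb i 0 ?u * of_nat (i + 1) else 0)"
    unfolding lam_op_derivation[OF assms, of "block_J 0"] evp_block_bracket
    by (rule sum.cong) (auto simp: evb_J)
  also have "\<dots> = evb k 0 ?u * of_nat (k + 1)"
    by simp
  finally show ?thesis
    by (metis mult_eq_0_iff of_nat_eq_0_iff add_is_0 one_neq_zero)
qed

text \<open>Each coefficient polynomial has the root 0, so \<partial> divides it; the quotients form
  \<open>a\<close>.\<close>

lemma partial_op_surj_on_zeros:
  assumes "\<And>k. evb k 0 u = 0"
  obtains a where "u = partial_op block_scale a"
proof
  define a where "a = Poly_Mapping.map (\<lambda>f. f div [:0, 1:]) u"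
  have "Poly_Mapping.lookup a k = Poly_Mapping.lookup u k div [:0, 1:]" for k
    by (simp add: a_def Poly_Mapping.map.rep_eq when_def)
  moreover have "[:0, 1:] dvd Poly_Mapping.lookup u k" for k
    using assms[of k] poly_eq_0_iff_dvd[of "Poly_Mapping.lookup u k" 0] by (simp add: evb_def)
  ultimately have "Poly_Mapping.lookup u k = [:0, 1:] * Poly_Mapping.lookup a k" for k
    by (metis dvd_mult_div_cancel)
  then show "u = partial_op block_scale a"
    by (intro evb_eqI) (simp add: evb_def[of _ _ u] evb_def[of _ _ a])
qed

theorem proposition3p3:
  fixes d :: "block \<Rightarrow> block poly"
  assumes "block.conformal_derivation d"
  shows "\<exists>a. \<forall>b. d b = block_bracket a b"
proof -
  obtain a where a: "subst_neg_partial (d (block_J 0)) = partial_op block_scale a"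
    using partial_op_surj_on_zeros evb_0_subst_neg_partial[OF assms] by metis
  \<comment> \<open>The sign of \<open>- a\<close> absorbs the one in
    \<open>br_partial_left\<close>.\<close>
  have "d b = block_bracket (- a) b" for b
  proof -
    have "block_bracket (- a) b = - block_bracket a b"
      using block.br_add_left[of "- a" a b] by (simp add: eq_neg_iff_add_eq_0)
    moreover have "lam_op (d b) = - lam_op (block_bracket a b)"
      by (simp add: lam_op_derivation[OF assms] a block.br_partial_left)
    ultimately show ?thesis
      by (simp add: lam_op_def)
  qed
  then show ?thesis
    by blast
qed

end
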